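(* Let $n\in\mathbb{N}^+$, $a_1,\dots,a_n>0$, and let $m,p,t,r,\beta\in\mathbb{R}$ with $t\ge 0$ and $p\neq 0$. Put $s=\sum_{i=1}^n a_i^p$ and assume $ts>r a_i^p$ for each $i=1,\dots,n$. Let $T=s$ if $r\le t$ and $T=ts/r$ if $r>t$, and let $X_1<X_2$ be as defined in the context. (1) Suppose that $\beta,r,m,p,t$ satisfy one of the following four cases: (i) $\beta r=0$ and $m(m-p)\ge 0$; (ii) $\beta=-1$, $r\ne 0$ and either (ii.1) $m(m-p)t\ge 0$ and $m(m+p)r\le 0$, or (ii.2) $m(m-p)t>0$, $m(m+p)r>0$ and $\dfrac{(m-p)ts}{(m+p)r}\ge T$; (iii) $\beta\in(-\infty,-1)\cup(0,+\infty)$, $r\neq 0$ and one of the following holds: (iii.1) $\beta pm>0$ and $p[m-(\beta+1)p]\ge 0$, (iii.2) $\beta m[m-(\beta+1)p]\ge 0$, (iii.3) $mrp\beta\ge 0$ and $m(m-p)\ge 0$, (iii.4) $t>r$, $mrp\beta<0$, $m(m-p)>0$, $\beta m[m-(\beta+1)p]<0$ and $(t-r)X_1\ge 1$; (iv) $\beta\in(-1,0)$, $t>r\ne 0$, $m(m-p)\ge 0$, $m[m-(\beta+1)p]>0$ and $(t-r)X_2\ge 1$. Then $$\sum_{i=1}^n\frac{a_i^m}{(ts-ra_i^p)^\beta}\ \ge\ \frac{n^{\beta+1-\frac mp}}{(nt-r)^{\beta}}\left(\sum_{i=1}^n a_i^p\right)^{\frac mp-\beta}.$$ (2) Suppose that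 $\beta,r,m,p,t$ satisfy one of the following cases: (v) $\beta r=0$ and $m(m-p)\le 0$; (vi) $\beta=-1$, $r\ne 0$ and either (vi.1) $m(m-p)t\le 0$ and $m(m+p)r\ge 0$, or (vi.2) $m(m-p)t<0$, $m(m+p)r<0$ and $\dfrac{(m-p)ts}{(m+p)r}\ge T$; (vii) $\beta\in(-1,0)$ and one of the following holds: (vii.1) $0\le pm\le(\beta+1)p^2$, (vii.2) $mrp\ge 0$ and $m(m-p)\ge 0$, (vii.3) $r<0$, $(\beta+1)p^2<pm\le p^2$ and $(t-r)X_1\ge 1$; (viii) $\beta\in(-\infty,-1)\cup(0,+\infty)$, $t>r\ne 0$, $m(m-p)\le 0$, $\beta m[m-(\beta+1)p]<0$ and $(t-r)X_2\ge 1$. Then $$\sum_{i=1}^n\frac{a_i^m}{(ts-ra_i^p)^\beta}\ \le\ \frac{n^{\beta+1-\frac mp}}{(nt-r)^{\beta}}\left(\sum_{i=1}^n a_i^p\right)^{\frac mp-\beta}.$$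
   Context: For $\beta(\beta+1)r\neq 0$ (and $p\ne0$) let $f:\mathbb{R}\to\mathbb{R}$ be the quadratic function $$f(x)=x^2+\frac{2m}{(\beta+1)rp}x+\frac{m(m-p)}{\beta(\beta+1)r^2p^2}.$$ When the equation $f(x)=0$ has two different real solutions, they are denoted $X_1<X_2$, i.e. $$X_1=-\frac{m}{(\beta+1)rp}-\sqrt{\frac{m(\beta p+p-m)}{\beta(\beta+1)^2r^2p^2}},\qquad X_2=-\frac{m}{(\beta+1)rp}+\sqrt{\frac{m(\beta p+p-m)}{\beta(\beta+1)^2r^2p^2}}.$$ The assumption $ts>ra_i^p$ for all $i$ implies $nt>r$, so the right-hand sides make sense. All powers are real powers of positive numbers.
   Formalization: In case (vii.2) the printed condition m(m-p) ≥ 0 is replaced by m(m-p) ≤ 0; as printed, part (2) fails for n=2, a=(1,2), β=-1/2, m=2, p=t=1, r=0. *)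

theory Defs
  imports "HOL-Analysis.Analysis"
begin

text \<open>
  The quadratic function \<open>f\<close>, considered only for \<open>\<beta> * (\<beta> + 1) * r * p \<noteq> 0\<close>, and the two closed
  forms \<open>X1 < X2\<close> of its roots, meaningful only where \<open>f\<close> has two different real roots; see
  \<open>X1_X2_roots\<close>.
\<close>

definition quad_f :: "real \<Rightarrow> real \<Rightarrow> real \<Rightarrow> real \<Rightarrow> real \<Rightarrow> real" where
  "quad_f \<beta> r m p x =
     x\<^sup>2 + 2 * m / ((\<beta> + 1) * r * p) * x + m * (m - p) / (\<beta> * (\<beta> + 1) * r\<^sup>2 * p\<^sup>2)"

definition X1 :: "real \<Rightarrow> real \<Rightarrow> real \<Rightarrow> real \<Rightarrow> real" where
  "X1 \<beta> r m p = - (m / ((\<beta> + 1) * r * p))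
     - sqrt (m * (\<beta> * p + p - m) / (\<beta> * (\<beta> + 1)\<^sup>2 * r\<^sup>2 * p\<^sup>2))"

definition X2 :: "real \<Rightarrow> real \<Rightarrow> real \<Rightarrow> real \<Rightarrow> real" where
  "X2 \<beta> r m p = - (m / ((\<beta> + 1) * r * p))
     + sqrt (m * (\<beta> * p + p - m) / (\<beta> * (\<beta> + 1)\<^sup>2 * r\<^sup>2 * p\<^sup>2))"

lemma quad_f_completed_square:
  assumes "\<beta> * (\<beta> + 1) * r \<noteq> 0" "p \<noteq> 0"
  shows "quad_f \<beta> r m p x = (x + m / ((\<beta> + 1) * r * p))\<^sup>2
           - m * (\<beta> * p + p - m) / (\<beta> * (\<beta> + 1)\<^sup>2 * r\<^sup>2 * p\<^sup>2)"
proof -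
  define b where "b = \<beta> + 1"
  have nz: "\<beta> \<noteq> 0" "b \<noteq> 0" "r \<noteq> 0" using assms by (auto simp: b_def)
  have b: "\<beta> * p + p - m = b * p - m" "\<beta> = b - 1" by (auto simp: b_def algebra_simps)
  have "m * (m - p) / (\<beta> * b * r\<^sup>2 * p\<^sup>2)
          = (m / (b * r * p))\<^sup>2 - m * (b * p - m) / (\<beta> * b\<^sup>2 * r\<^sup>2 * p\<^sup>2)"
    using nz assms(2) b(2) by (simp add: divide_simps power2_eq_square) (simp add: algebra_simps)
  then show ?thesis
    unfolding quad_f_def b(1) b_def[symmetric]
    by (simp add: power2_sum)
qed

lemma X1_X2_roots:
  assumes "\<beta> * (\<beta> + 1) * r \<noteq> 0" "p \<noteq> 0"
    and "m * (\<beta> * p + p - m) / (\<beta> * (\<beta> + 1)\<^sup>2 * r\<^sup>2 * p\<^sup>2) > 0"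
  shows "X1 \<beta> r m p < X2 \<beta> r m p"
    and "quad_f \<beta> r m p x = 0 \<longleftrightarrow> x = X1 \<beta> r m p \<or> x = X2 \<beta> r m p"
proof -
  define D where "D = m * (\<beta> * p + p - m) / (\<beta> * (\<beta> + 1)\<^sup>2 * r\<^sup>2 * p\<^sup>2)"
  define c where "c = m / ((\<beta> + 1) * r * p)"
  have D: "D > 0" using assms(3) by (simp add: D_def)
  show "X1 \<beta> r m p < X2 \<beta> r m p"
    using D unfolding X1_def X2_def D_def[symmetric] by simp
  have "quad_f \<beta> r m p x = (x + c)\<^sup>2 - (sqrt D)\<^sup>2"
    using quad_f_completed_square[OF assms(1,2)] D by (simp add: D_def c_def)
  also have "\<dots> = 0 \<longleftrightarrow> x + c = sqrt D \<or> x + c = - sqrt D"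
    by (simp add: power2_eq_iff del: real_sqrt_pow2_iff real_sqrt_pow2)
  also have "\<dots> \<longleftrightarrow> x = - c - sqrt D \<or> x = - c + sqrt D" by auto
  finally show "quad_f \<beta> r m p x = 0 \<longleftrightarrow> x = X1 \<beta> r m p \<or> x = X2 \<beta> r m p"
    unfolding X1_def X2_def D_def[symmetric] c_def[symmetric] .
qed

text \<open>
  In the range \<open>-1 < \<beta> < 0\<close> of the upper bound, the source prints the second alternative as
  \<open>m * r * p \<ge> 0\<close> and \<open>m * (m - p) \<ge> 0\<close>.  The sign of the second inequality is a misprint for
  \<open>m * (m - p) \<le> 0\<close>: as printed, the alternative admits the following counterexample
  (\<open>n = 2\<close>, \<open>a = (1, 2)\<close>, \<open>\<beta> = -1/2\<close>, \<open>m = 2\<close>, \<open>p = t = 1\<close>, \<open>r = 0\<close>).  The proof by the sign of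
  \<open>quad_f\<close> on the positive half-line (all three coefficients nonnegative) needs \<open>\<le>\<close>.
\<close>

lemma printed_alternative_false:
  fixes a :: "nat \<Rightarrow> real" and \<beta> m p r s t :: real and n :: nat
  assumes "a = real" "n = 2" "\<beta> = -1/2" "m = 2" "p = 1" "r = 0" "t = 1"
    and "s = (\<Sum>i=1..n. a i powr p)"
  shows "n \<ge> 1 \<and> t \<ge> 0 \<and> p \<noteq> 0 \<and> (\<forall>i\<in>{1..n}. a i > 0 \<and> t * s > r * a i powr p)"
    and "\<beta> \<in> {-1<..<0} \<and> m * r * p \<ge> 0 \<and> m * (m - p) \<ge> 0"
    and "\<not> (\<Sum>i=1..n. a i powr m / (t * s - r * a i powr p) powr \<beta>)
           \<le> real n powr (\<beta> + 1 - m / p) / (real n * t - r) powr \<beta> * s powr (m / p - \<beta>)"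
proof -
  have s: "s = 3" using assms by (simp add: numeral_2_eq_2)
  show "n \<ge> 1 \<and> t \<ge> 0 \<and> p \<noteq> 0 \<and> (\<forall>i\<in>{1..n}. a i > 0 \<and> t * s > r * a i powr p)"
    using assms s by auto
  show "\<beta> \<in> {-1<..<0} \<and> m * r * p \<ge> 0 \<and> m * (m - p) \<ge> 0"
    using assms by auto
  have l: "(\<Sum>i=1..n. a i powr m / (t * s - r * a i powr p) powr \<beta>) = 5 / 3 powr (-1/2)"
    using assms s by (simp add: numeral_2_eq_2 flip: add_divide_distrib)
  have "(2::real) powr (\<beta> + 1 - m / p) / (real n * t - r) powr \<beta> = 2 powr (-1)"
    using assms by (simp flip: powr_diff)
  moreover have "s powr (m / p - \<beta>) = 3 powr 2 / 3 powr (-1/2)"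
    using assms s powr_diff[of "3::real" 2 "-1/2"] by simp
  ultimately have r: "real n powr (\<beta> + 1 - m / p) / (real n * t - r) powr \<beta> * s powr (m / p - \<beta>)
      = (9/2) / 3 powr (-1/2)"
    using assms by (simp add: powr_minus_divide)
  show "\<not> (\<Sum>i=1..n. a i powr m / (t * s - r * a i powr p) powr \<beta>)
           \<le> real n powr (\<beta> + 1 - m / p) / (real n * t - r) powr \<beta> * s powr (m / p - \<beta>)"
    unfolding l r not_le by (intro divide_strict_right_mono) auto
qed

end

theory Submission
  imports Defs
begin

text \<open>
  With \<open>b i = a i powr p\<close> the claim is Jensen's inequality, at the mean \<open>s / n\<close> of the \<open>b i\<close>, for
  \<open>g x = x powr (m / p) / (t * s - r * x) powr \<beta>\<close> on the points of \<open>(0, s]\<close> where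
  \<open>t * s - r * x\<close> is positive.  Writing \<open>y = t * s - r * x\<close>, the second derivative of \<open>g\<close> has the
  sign of a quadratic form in \<open>(x, y)\<close>, which equals \<open>\<beta> (\<beta> + 1) (r p y)\<^sup>2 * quad_f (x / y)\<close> when
  \<open>\<beta> (\<beta> + 1) r \<noteq> 0\<close>.  The bound \<open>x \<le> s\<close> reads \<open>(t - r) (x / y) \<le> 1\<close>, so the hypotheses on \<open>X1\<close> and
  \<open>X2\<close> locate \<open>x / y\<close> relative to the roots; each listed case fixes the sign of the form.
\<close>

text \<open>Free of division, so it still makes sense when
  \<open>\<beta> * (\<beta> + 1) * r = 0\<close>, where \<open>quad_f\<close> does not. The slot
  \<open>y\<close> is meant for \<open>t * s - r * x\<close>.\<close>

definition hess_form :: "real \<Rightarrow> real \<Rightarrow> real \<Rightarrow> real \<Rightarrow> real \<Rightarrow> real \<Rightarrow> real" where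
  "hess_form \<beta> r m p x y =
     m * (m - p) * y\<^sup>2 + 2 * (m * r * p * \<beta>) * (x * y) + \<beta> * (\<beta> + 1) * (p * r * x)\<^sup>2"

lemma hess_form_eq_quad_f:
  assumes "\<beta> * (\<beta> + 1) * r \<noteq> 0" "p \<noteq> 0" "y \<noteq> 0"
  shows "hess_form \<beta> r m p x y = \<beta> * (\<beta> + 1) * (r * p * y)\<^sup>2 * quad_f \<beta> r m p (x / y)"
proof -
  define b where "b = \<beta> + 1"
  have nz: "\<beta> \<noteq> 0" "b \<noteq> 0" "r \<noteq> 0" using assms by (auto simp: b_def)
  show ?thesis
    unfolding hess_form_def quad_f_def b_def[symmetric]
    using nz assms(2,3) by (simp add: field_simps power2_eq_square)
qed

text \<open>The discriminant of the form, as a polynomial in \<open>x / y\<close>, is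
  \<open>- 4 * (p * r)\<^sup>2\<close> times the coefficient left on \<open>y\<^sup>2\<close>. A
  nonnegative coefficient therefore rules out a change of sign.\<close>

lemma hess_form_completed_square:
  "\<beta> * (\<beta> + 1) * hess_form \<beta> r m p x y =
     (\<beta> * (\<beta> + 1) * p * r * x + m * \<beta> * y)\<^sup>2 + \<beta> * m * (m - (\<beta> + 1) * p) * y\<^sup>2"
  unfolding hess_form_def by (simp add: algebra_simps power2_eq_square)

text \<open>At \<beta> = -1 the \<open>x\<^sup>2\<close> term vanishes, so
  \<open>y = c - r * x\<close> factors out and what remains is linear in \<open>x\<close>.\<close>

lemma hess_form_minus_one:
  "hess_form (-1) r m p x (c - r * x) = (c - r * x) * (m * (m - p) * c - m * (m + p) * r * x)"
  unfolding hess_form_def by (simp add: algebra_simps power2_eq_square)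

lemma quad_f_nonneg_left_X1:
  assumes "\<beta> * (\<beta> + 1) * r \<noteq> 0" "p \<noteq> 0" "x \<le> X1 \<beta> r m p"
  shows "quad_f \<beta> r m p x \<ge> 0"
proof -
  define D where "D = m * (\<beta> * p + p - m) / (\<beta> * (\<beta> + 1)\<^sup>2 * r\<^sup>2 * p\<^sup>2)"
  define c where "c = m / ((\<beta> + 1) * r * p)"
  have "sqrt D \<le> - (x + c)"
    using assms(3) unfolding X1_def D_def[symmetric] c_def[symmetric] by simp
  \<comment> \<open>If \<open>D\<close> is negative, so is \<open>sqrt D\<close>, and
    \<open>D\<close> lies below any square; the case without real roots is thus covered too.\<close>
  then have "D \<le> (- (x + c))\<^sup>2" by (rule sqrt_le_D)
  then show ?thesis
    unfolding quad_f_completed_square[OF assms(1,2)] D_def c_def by (simp only: power2_minus)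
qed

text \<open>A nonpositive value at 0 forces real roots with 0 between them, so a nonnegative point
  can leave the root interval only through \<open>X2\<close>.\<close>

lemma quad_f_nonpos_left_X2:
  assumes "\<beta> * (\<beta> + 1) * r \<noteq> 0" "p \<noteq> 0" "0 \<le> x" "x \<le> X2 \<beta> r m p"
    and "quad_f \<beta> r m p 0 \<le> 0"
  shows "quad_f \<beta> r m p x \<le> 0"
proof -
  define D where "D = m * (\<beta> * p + p - m) / (\<beta> * (\<beta> + 1)\<^sup>2 * r\<^sup>2 * p\<^sup>2)"
  define c where "c = m / ((\<beta> + 1) * r * p)"
  have f: "quad_f \<beta> r m p z = (z + c)\<^sup>2 - D" for z
    unfolding quad_f_completed_square[OF assms(1,2)] D_def c_def ..
  have "\<bar>c\<bar> \<le> sqrt D" using assms(5) f[of 0] by (intro real_le_rsqrt) auto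
  moreover have "x + c \<le> sqrt D"
    using assms(4) unfolding X2_def D_def[symmetric] c_def[symmetric] by simp
  ultimately have "\<bar>x + c\<bar> \<le> sqrt D" using assms(3) by linarith
  then have "(x + c)\<^sup>2 \<le> D" by (rule sqrt_ge_absD)
  then show ?thesis by (simp add: f)
qed

text \<open>With \<open>y = t * s - r * x\<close>, the bound \<open>t * x \<le> t * s\<close> gives
  \<open>(t - r) * x \<le> y \<le> (t - r) * X * y\<close>, and the positive factor
  \<open>t - r\<close> cancels. It serves with \<open>X1\<close> and \<open>X2\<close> in place of
  \<open>X\<close>.\<close>

lemma sector_bound:
  fixes t r s x X :: real
  assumes "0 \<le> t" "x \<le> s" "0 < t * s - r * x" "r < t" "1 \<le> (t - r) * X"
  shows "x / (t * s - r * x) \<le> X"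
proof -
  define y where "y = t * s - r * x"
  have "(t - r) * x \<le> y"
    using mult_left_mono[OF assms(2,1)] by (simp add: y_def algebra_simps)
  also have "y \<le> (t - r) * X * y"
    using assms(3,5) by (simp add: y_def)
  finally have "x \<le> X * y" using assms(4) by (simp add: mult.assoc)
  then show ?thesis using assms(3) by (simp add: y_def[symmetric] divide_le_eq)
qed

lemma hess_form_nonneg_of_discriminant:
  assumes "\<beta> * (\<beta> + 1) > 0" "\<beta> * m * (m - (\<beta> + 1) * p) \<ge> 0"
  shows "hess_form \<beta> r m p x y \<ge> 0"
proof -
  have "\<beta> * (\<beta> + 1) * hess_form \<beta> r m p x y \<ge> 0"
    unfolding hess_form_completed_square using assms(2) by simp
  then show ?thesis using assms(1) by (simp add: zero_le_mult_iff)
qed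

text \<open>The completed square is again a sum of nonnegative terms, but the leading factor to be
  cancelled is negative.\<close>

lemma hess_form_nonpos_of_discriminant:
  assumes "\<beta> * (\<beta> + 1) < 0" "\<beta> * m * (m - (\<beta> + 1) * p) \<ge> 0"
  shows "hess_form \<beta> r m p x y \<le> 0"
proof -
  have "\<beta> * (\<beta> + 1) * hess_form \<beta> r m p x y \<ge> 0"
    unfolding hess_form_completed_square using assms(2) by simp
  then show ?thesis using assms(1) mult_neg_pos[of "\<beta> * (\<beta> + 1)"] by (meson not_le)
qed

text \<open>Jensen with all weights \<open>1 / card I\<close>, multiplied through by
  \<open>card I\<close>.\<close>

lemma jensen_sum:
  fixes b :: "'i \<Rightarrow> real" and g :: "real \<Rightarrow> real"
  assumes "finite I" "I \<noteq> {}" "convex_on C g" "\<And>i. i \<in> I \<Longrightarrow> b i \<in> C"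
  shows "card I * g (sum b I / card I) \<le> (\<Sum>i\<in>I. g (b i))"
proof -
  have "card I > 0" using assms(1,2) by (simp add: card_gt_0_iff)
  moreover have "g (\<Sum>i\<in>I. (1 / card I) *\<^sub>R b i) \<le> (\<Sum>i\<in>I. (1 / card I) * g (b i))"
    using assms calculation by (intro convex_on_sum) auto
  ultimately show ?thesis
    by (simp add: sum_distrib_left[symmetric] sum_divide_distrib[symmetric] field_simps)
qed

text \<open>The derivative is kept as \<open>g\<close> times the logarithmic derivative
  \<open>L\<close>, so that differentiating again gives \<open>g * (L\<^sup>2 + L')\<close>.\<close>

lemma DERIV_powr_div_powr:
  fixes k c r \<beta> x :: real
  assumes "0 < x" "0 < c - r * x"
  defines "g \<equiv> \<lambda>x. x powr k / (c - r * x) powr \<beta>"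
  shows "(g has_real_derivative g x * (k / x + \<beta> * r / (c - r * x))) (at x)"
proof -
  have "((\<lambda>x. (c - r * x) powr \<beta>) has_real_derivative
      \<beta> * (c - r * x) powr (\<beta> - 1) * (- r)) (at x)"
    using assms(2)
    by (intro DERIV_chain2[OF has_real_derivative_powr]) (auto intro!: derivative_eq_intros)
  from DERIV_divide[OF has_real_derivative_powr[OF assms(1)] this]
  have "((\<lambda>x. x powr k / (c - r * x) powr \<beta>) has_real_derivative
     ((k * x powr (k - 1)) * (c - r * x) powr \<beta> - x powr k * (\<beta> * (c - r * x) powr (\<beta> - 1) * (- r)))
      / ((c - r * x) powr \<beta> * (c - r * x) powr \<beta>)) (at x)"
    using assms(2) by simp
  \<comment> \<open>Naming the two powers \<open>X\<close> and \<open>Y\<close>, and writing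
    exponents lowered by one as quotients, turns the quotient rule into a rational identity;
    \<open>z\<close> below stands for \<open>c - r * x\<close>.\<close>
  moreover have "((k * x powr (k - 1)) * Y - X * (\<beta> * (c - r * x) powr (\<beta> - 1) * (- r)))
      / (Y * Y) = X / Y * (k / x + \<beta> * r / (c - r * x))"
    if "X = x powr k" "Y = (c - r * x) powr \<beta>" for X Y
  proof -
    have "x powr (k - 1) = X / x" "(c - r * x) powr (\<beta> - 1) = Y / (c - r * x)" "Y > 0"
      using assms(1,2) that by (simp_all add: powr_diff)
    moreover have "(k * (X / x) * Y - X * (\<beta> * (Y / z) * (- r))) / (Y * Y)
        = X / Y * (k / x + \<beta> * r / z)" if "z > 0" for z
      using assms(1) that \<open>Y > 0\<close> by (simp add: divide_simps) (simp add: algebra_simps)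
    ultimately show ?thesis using assms(2) by simp
  qed
  ultimately show ?thesis unfolding g_def by simp
qed

lemma DERIV2_powr_div_powr:
  fixes c r \<beta> m p x :: real
  assumes "0 < x" "0 < c - r * x" "p \<noteq> 0"
  defines "g \<equiv> \<lambda>x. x powr (m / p) / (c - r * x) powr \<beta>"
  shows "((\<lambda>x. g x * (m / p / x + \<beta> * r / (c - r * x))) has_real_derivative
      g x * hess_form \<beta> r m p x (c - r * x) / (p * x * (c - r * x))\<^sup>2) (at x)"
proof -
  define y where "y = c - r * x"
  have y: "y > 0" using assms(2) by (simp add: y_def)
  have h1: "((\<lambda>x. m / p / x + \<beta> * r / (c - r * x)) has_real_derivative
      \<beta> * r\<^sup>2 / y\<^sup>2 - m / p / x\<^sup>2) (at x)"
    using assms(1-3) unfolding y_def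
    by (auto intro!: derivative_eq_intros simp: power2_eq_square ac_simps)
  have g1: "(g has_real_derivative g x * (m / p / x + \<beta> * r / y)) (at x)"
    unfolding g_def y_def by (rule DERIV_powr_div_powr[OF assms(1,2)])
  have "((\<lambda>x. g x * (m / p / x + \<beta> * r / (c - r * x))) has_real_derivative
      g x * ((m / p / x + \<beta> * r / y)\<^sup>2 + (\<beta> * r\<^sup>2 / y\<^sup>2 - m / p / x\<^sup>2))) (at x)"
    by (rule DERIV_cong[OF DERIV_mult[OF g1 h1]]) (simp add: y_def power2_eq_square algebra_simps)
  \<comment> \<open>Over the common denominator \<open>(p * x * y)\<^sup>2\<close> the numerator is
    exactly \<open>hess_form\<close>.\<close>
  moreover have "(m / p / x + \<beta> * r / y)\<^sup>2 + (\<beta> * r\<^sup>2 / y\<^sup>2 - m / p / x\<^sup>2)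
      = hess_form \<beta> r m p x y / (p * x * y)\<^sup>2"
    using assms(1,3) y unfolding hess_form_def
    by (simp add: divide_simps power2_eq_square) (simp add: algebra_simps)
  ultimately show ?thesis unfolding y_def by simp
qed

theorem theorem3p1:
  fixes n :: nat and a :: "nat \<Rightarrow> real" and m p t r \<beta> s T :: real
  assumes "n \<ge> 1"
    and "\<And>i. i \<in> {1..n} \<Longrightarrow> a i > 0"
    and "t \<ge> 0" and "p \<noteq> 0"
    and "s = (\<Sum>i=1..n. a i powr p)"
    and "\<And>i. i \<in> {1..n} \<Longrightarrow> t * s > r * a i powr p"
    and "T = (if r \<le> t then s else t * s / r)"
  shows
    "(
      (\<beta> * r = 0 \<and> m * (m - p) \<ge> 0)
      \<or>
      (\<beta> = -1 \<and> r \<noteq> 0 \<and>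
        ((m * (m - p) * t \<ge> 0 \<and> m * (m + p) * r \<le> 0) \<or>
         (m * (m - p) * t > 0 \<and> m * (m + p) * r > 0 \<and>
            (m - p) * t * s / ((m + p) * r) \<ge> T)))
      \<or>
      (\<beta> \<in> {..<-1} \<union> {0<..} \<and> r \<noteq> 0 \<and>
        ((\<beta> * p * m > 0 \<and> p * (m - (\<beta> + 1) * p) \<ge> 0) \<or>
         (\<beta> * m * (m - (\<beta> + 1) * p) \<ge> 0) \<or>
         (m * r * p * \<beta> \<ge> 0 \<and> m * (m - p) \<ge> 0) \<or>
         (t > r \<and> m * r * p * \<beta> < 0 \<and> m * (m - p) > 0 \<and>
            \<beta> * m * (m - (\<beta> + 1) * p) < 0 \<and> (t - r) * X1 \<beta> r m p \<ge> 1)))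
      \<or>
      (\<beta> \<in> {-1<..<0} \<and> t > r \<and> r \<noteq> 0 \<and> m * (m - p) \<ge> 0 \<and>
        m * (m - (\<beta> + 1) * p) > 0 \<and> (t - r) * X2 \<beta> r m p \<ge> 1)
     \<longrightarrow>
      (\<Sum>i=1..n. a i powr m / (t * s - r * a i powr p) powr \<beta>)
        \<ge> real n powr (\<beta> + 1 - m / p) / (real n * t - r) powr \<beta>
            * (\<Sum>i=1..n. a i powr p) powr (m / p - \<beta>))
    \<and>
     (
      (\<beta> * r = 0 \<and> m * (m - p) \<le> 0)
      \<or>
      (\<beta> = -1 \<and> r \<noteq> 0 \<and>
        ((m * (m - p) * t \<le> 0 \<and> m * (m + p) * r \<ge> 0) \<or>
         (m * (m - p) * t < 0 \<and> m * (m + p) * r < 0 \<and>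
            (m - p) * t * s / ((m + p) * r) \<ge> T)))
      \<or>
      (\<beta> \<in> {-1<..<0} \<and>
        ((0 \<le> p * m \<and> p * m \<le> (\<beta> + 1) * p\<^sup>2) \<or>
         (m * r * p \<ge> 0 \<and> m * (m - p) \<le> 0) \<or>
         (r < 0 \<and> (\<beta> + 1) * p\<^sup>2 < p * m \<and> p * m \<le> p\<^sup>2 \<and> (t - r) * X1 \<beta> r m p \<ge> 1)))
      \<or>
      (\<beta> \<in> {..<-1} \<union> {0<..} \<and> t > r \<and> r \<noteq> 0 \<and> m * (m - p) \<le> 0 \<and>
        \<beta> * m * (m - (\<beta> + 1) * p) < 0 \<and> (t - r) * X2 \<beta> r m p \<ge> 1)
     \<longrightarrow>
      (\<Sum>i=1..n. a i powr m / (t * s - r * a i powr p) powr \<beta>)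
        \<le> real n powr (\<beta> + 1 - m / p) / (real n * t - r) powr \<beta>
            * (\<Sum>i=1..n. a i powr p) powr (m / p - \<beta>))"
    (is "(?lower_cases \<longrightarrow> ?lower) \<and> (?upper_cases \<longrightarrow> ?upper)")
proof -

  \<comment> \<open>Reduction to Jensen's inequality on \<open>C\<close>\<close>
  define b where "b i = a i powr p" for i
  define C where "C = {x. 0 < x \<and> x \<le> s \<and> r * x < t * s}"
  define g where "g x = x powr (m / p) / (t * s - r * x) powr \<beta>" for x
  define g' where "g' x = g x * (m / p / x + \<beta> * r / (t * s - r * x))" for x
  define g'' where
    "g'' x = g x * hess_form \<beta> r m p x (t * s - r * x) / (p * x * (t * s - r * x))\<^sup>2" for x
  have CE: "0 < x" "x \<le> s" "0 < t * s - r * x" if "x \<in> C" for x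
    using that by (auto simp: C_def)
  have s: "s = sum b {1..n}" using assms(5) by (simp add: b_def)
  have b_pos: "b i > 0" if "i \<in> {1..n}" for i
    using assms(2)[OF that] by (simp add: b_def)
  have b_C: "b i \<in> C" if "i \<in> {1..n}" for i
  proof -
    have "b i \<le> s" unfolding s
      using that b_pos by (intro member_le_sum) (auto intro: less_imp_le)
    then show ?thesis using assms(6)[OF that] b_pos[OF that] by (auto simp: C_def b_def)
  qed
  have s_pos: "s > 0" unfolding s using b_pos assms(1) by (intro sum_pos) auto
  \<comment> \<open>Summing \<open>r * b i < t * s\<close> over \<open>i\<close> gives
    \<open>r * s < n * t * s\<close>, and \<open>s\<close> is positive.\<close>
  have nt: "real n * t - r > 0"
  proof -
    have "(\<Sum>i=1..n. r * b i) < (\<Sum>i=1..n. t * s)"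
      using assms(1,6) by (intro sum_strict_mono) (auto simp: b_def)
    then have "r * s < real n * t * s" by (simp add: s sum_distrib_left[symmetric] mult.assoc)
    then show ?thesis using s_pos by simp
  qed
  have sum_g: "(\<Sum>i=1..n. a i powr m / (t * s - r * a i powr p) powr \<beta>) = (\<Sum>i=1..n. g (b i))"
    using assms(4) by (intro sum.cong refl) (simp add: g_def b_def powr_powr)
  \<comment> \<open>At the mean, both bases in \<open>g\<close> are multiples of
    \<open>s / n\<close>, so the powers of \<open>n\<close> and \<open>s\<close> separate.\<close>
  have mean_g: "real n powr (\<beta> + 1 - m / p) / (real n * t - r) powr \<beta>
      * (\<Sum>i=1..n. a i powr p) powr (m / p - \<beta>) = card {1..n} * g (sum b {1..n} / card {1..n})"
  proof -
    have n: "real n > 0" using assms(1) by simp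
    have "t * s - r * (s / n) = (real n * t - r) * s / n"
      using n by (simp add: field_simps)
    then have "n * g (s / n) = n * (s powr (m / p) / n powr (m / p))
        / ((real n * t - r) powr \<beta> * s powr \<beta> / n powr \<beta>)"
      unfolding g_def using n s_pos nt by (simp add: powr_divide powr_mult)
    also have "\<dots> = real n powr (\<beta> + 1 - m / p) / (real n * t - r) powr \<beta> * s powr (m / p - \<beta>)"
      using n s_pos nt by (simp add: powr_diff powr_add field_simps)
    finally show ?thesis unfolding assms(5)[symmetric] s[symmetric] by simp
  qed
  have C_convex: "convex C"
  proof -
    have "C = {0<..} \<inter> {..s} \<inter> {x. r * x < t * s}" by (auto simp: C_def)
    moreover have "convex {x. r * x < t * s}"
      using convex_halfspace_lt[of r "t * s"] by simp
    ultimately show ?thesis by (auto intro!: convex_Int)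
  qed
  have D1: "(g has_real_derivative g' x) (at x)" if "x \<in> C" for x
    unfolding g_def g'_def using DERIV_powr_div_powr CE[OF that] by blast
  have D2: "(g' has_real_derivative g'' x) (at x)" if "x \<in> C" for x
    unfolding g_def g'_def g''_def using DERIV2_powr_div_powr CE[OF that] assms(4) by blast
  have g_nonneg: "g x \<ge> 0" for x by (simp add: g_def)

  \<comment> \<open>The form without its factor \<open>\<beta> * (\<beta> + 1)\<close>: the sign of
    \<open>F\<close> comes from the position relative to the roots, that of the factor from the
    range of \<beta>, and both bounds share the former.\<close>
  define F where
    "F x = (r * p * (t * s - r * x))\<^sup>2 * quad_f \<beta> r m p (x / (t * s - r * x))" for x
  have form: "hess_form \<beta> r m p x (t * s - r * x) = \<beta> * (\<beta> + 1) * F x"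
    if "x \<in> C" "\<beta> * (\<beta> + 1) * r \<noteq> 0" for x
    using hess_form_eq_quad_f[OF that(2) assms(4) less_imp_neq[OF CE(3)[OF that(1)], symmetric]]
    by (simp only: F_def mult.assoc)
  have F_X1: "F x \<ge> 0"
    if "x \<in> C" "\<beta> * (\<beta> + 1) * r \<noteq> 0" "r < t" "(t - r) * X1 \<beta> r m p \<ge> 1" for x
  proof -
    have "quad_f \<beta> r m p (x / (t * s - r * x)) \<ge> 0"
      using quad_f_nonneg_left_X1[OF that(2) assms(4)] sector_bound[OF assms(3)] CE that by blast
    then show ?thesis by (simp add: F_def)
  qed
  have F_X2: "F x \<le> 0"
    if "x \<in> C" "\<beta> * (\<beta> + 1) * r \<noteq> 0" "r < t" "(t - r) * X2 \<beta> r m p \<ge> 1"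
      "m * (m - p) / (\<beta> * (\<beta> + 1)) \<le> 0" for x
  proof -
    \<comment> \<open>The constant term is the assumed ratio over a square; its sign puts 0 between
      the roots.\<close>
    have "quad_f \<beta> r m p 0 = m * (m - p) / (\<beta> * (\<beta> + 1)) * (1 / (r * p)\<^sup>2)"
      by (simp add: quad_f_def power_mult_distrib)
    then have "quad_f \<beta> r m p 0 \<le> 0"
      using mult_nonpos_nonneg[OF that(5), of "1 / (r * p)\<^sup>2"] by simp
    moreover have "0 \<le> x / (t * s - r * x)" using CE[OF that(1)] by simp
    ultimately have "quad_f \<beta> r m p (x / (t * s - r * x)) \<le> 0"
      using quad_f_nonpos_left_X2[OF that(2) assms(4)] sector_bound[OF assms(3)] CE that by blast
    then show ?thesis by (simp add: F_def mult_nonneg_nonpos)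
  qed
  \<comment> \<open>For \<open>r > t\<close> the constraint \<open>r * x < t * s\<close> is stricter
    than \<open>x \<le> s\<close>.\<close>
  have x_le_T: "x \<le> T" if "x \<in> C" for x
  proof (cases "r \<le> t")
    case True
    then show ?thesis unfolding assms(7) using CE(2)[OF that] by simp
  next
    case False
    have "r * x \<le> t * s" using CE(3)[OF that] by simp
    moreover have "r > 0" using False assms(3) by simp
    ultimately have "x \<le> t * s / r" by (simp add: pos_le_divide_eq mult.commute)
    then show ?thesis unfolding assms(7) using False by simp
  qed
  \<comment> \<open>The quotient is the zero of the linear factor in
    \<open>hess_form_minus_one\<close>. When \<open>T\<close> does not exceed it, all of
    \<open>C\<close> lies on one side of that zero.\<close>
  have at_T: "m * (m + p) * r * ((m - p) * t * s / ((m + p) * r)) = m * (m - p) * (t * s)"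
    if "m * (m + p) * r \<noteq> 0"
  proof -
    have "m * q * ((m - p) * t * s / q) = m * (m - p) * (t * s)" if "q \<noteq> 0" for q
      using that by simp
    from this[of "(m + p) * r"] show ?thesis using that by (simp only: mult.assoc) simp
  qed
  have outer: "\<beta> * (\<beta> + 1) > 0" if "\<beta> \<in> {..<-1} \<union> {0<..}"
    using that by (auto simp: zero_less_mult_iff)
  have inner: "\<beta> * (\<beta> + 1) < 0" if "\<beta> \<in> {-1<..<0}"
    using that by (auto simp: mult_less_0_iff)

  show ?thesis
  proof (intro conjI impI)

    \<comment> \<open>Lower bound: convexity of \<open>g\<close>\<close>
    assume cases: ?lower_cases
    have "hess_form \<beta> r m p x (t * s - r * x) \<ge> 0" if x: "x \<in> C" for x
    proof -
      note xy = CE[OF x]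
      \<comment> \<open>The cases sorted by method: degenerate form, linear factor (twice),
        discriminant, signs of coefficients, left of \<open>X1\<close>, between the roots.\<close>
      consider "\<beta> * r = 0" "m * (m - p) \<ge> 0"
        | "\<beta> = -1" "m * (m - p) * t \<ge> 0" "m * (m + p) * r \<le> 0"
        | "\<beta> = -1" "m * (m + p) * r > 0" "(m - p) * t * s / ((m + p) * r) \<ge> T"
        | "\<beta> * (\<beta> + 1) > 0" "\<beta> * m * (m - (\<beta> + 1) * p) \<ge> 0"
        | "\<beta> * (\<beta> + 1) > 0" "m * r * p * \<beta> \<ge> 0" "m * (m - p) \<ge> 0"
        | "\<beta> * (\<beta> + 1) > 0" "r \<noteq> 0" "r < t" "(t - r) * X1 \<beta> r m p \<ge> 1"
        | "\<beta> * (\<beta> + 1) < 0" "r \<noteq> 0" "r < t" "m * (m - p) \<ge> 0" "(t - r) * X2 \<beta> r m p \<ge> 1"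
      proof -
        \<comment> \<open>The product of the two hypotheses is \<open>p\<^sup>2\<close> times the
          discriminant coefficient, so this alternative joins the discriminant case.\<close>
        have "\<beta> * m * (m - (\<beta> + 1) * p) \<ge> 0"
          if "\<beta> * p * m > 0" "p * (m - (\<beta> + 1) * p) \<ge> 0"
        proof -
          have "0 \<le> \<beta> * p * m * (p * (m - (\<beta> + 1) * p))" using that by simp
          also have "\<dots> = p\<^sup>2 * (\<beta> * m * (m - (\<beta> + 1) * p))"
            by (simp add: power2_eq_square algebra_simps)
          finally show ?thesis using assms(4) by (simp add: zero_le_mult_iff)
        qed
        then show ?thesis using cases outer inner that by blast
      qed
      then show ?thesis
      proof cases
        case 1
        \<comment> \<open>Only the \<open>y\<^sup>2\<close> term survives.\<close>
        then show ?thesis by (auto simp: hess_form_def)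
      next
        case 2
        have "m * (m + p) * r * x \<le> 0" using 2 xy by (simp add: mult_nonpos_nonneg)
        moreover have "0 \<le> m * (m - p) * t * s" using 2 s_pos by simp
        ultimately show ?thesis
          using xy unfolding \<open>\<beta> = -1\<close> hess_form_minus_one by (simp add: mult.assoc)
      next
        case 3
        have "m * (m + p) * r * x \<le> m * (m + p) * r * ((m - p) * t * s / ((m + p) * r))"
          using 3 x_le_T[OF x] by (intro mult_left_mono) auto
        also have "\<dots> = m * (m - p) * (t * s)" using 3 by (intro at_T) auto
        finally show ?thesis using xy unfolding \<open>\<beta> = -1\<close> hess_form_minus_one by simp
      next
        case 4
        then show ?thesis by (rule hess_form_nonneg_of_discriminant)
      next
        case 5
        \<comment> \<open>All three coefficients are nonnegative, and \<open>x\<close> and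
          \<open>y\<close> are positive.\<close>
        then show ?thesis unfolding hess_form_def using xy by simp
      next
        case 6
        have nz: "\<beta> * (\<beta> + 1) * r \<noteq> 0" using 6 by auto
        show ?thesis
          unfolding form[OF x nz] using 6 F_X1[OF x nz] by (metis less_imp_le mult_nonneg_nonneg)
      next
        case 7
        have nz: "\<beta> * (\<beta> + 1) * r \<noteq> 0" using 7 by auto
        \<comment> \<open>This ratio places \<open>x / y\<close> between the roots, where
          \<open>quad_f\<close> is nonpositive; the negative leading factor makes the form
          nonnegative.\<close>
        have "m * (m - p) / (\<beta> * (\<beta> + 1)) \<le> 0" using 7 by (intro divide_nonneg_neg)
        then show ?thesis
          unfolding form[OF x nz] using 7 F_X2[OF x nz] by (metis less_imp_le mult_nonpos_nonpos)
      qed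
    qed
    then have "g'' x \<ge> 0" if "x \<in> C" for x
      using that g_nonneg by (simp add: g''_def)
    then have "convex_on C g" using f''_ge0_imp_convex[OF C_convex] D1 D2 by blast
    then show ?lower
      unfolding sum_g mean_g using assms(1) b_C by (intro jensen_sum) auto
  next

    \<comment> \<open>Upper bound: concavity of \<open>g\<close>\<close>
    assume cases: ?upper_cases
    have "hess_form \<beta> r m p x (t * s - r * x) \<le> 0" if x: "x \<in> C" for x
    proof -
      note xy = CE[OF x]
      consider "\<beta> * r = 0" "m * (m - p) \<le> 0"
        | "\<beta> = -1" "m * (m - p) * t \<le> 0" "m * (m + p) * r \<ge> 0"
        | "\<beta> = -1" "m * (m + p) * r < 0" "(m - p) * t * s / ((m + p) * r) \<ge> T"
        | "\<beta> * (\<beta> + 1) < 0" "\<beta> * m * (m - (\<beta> + 1) * p) \<ge> 0"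
        | "\<beta> * (\<beta> + 1) < 0" "m * r * p * \<beta> \<le> 0" "m * (m - p) \<le> 0"
        | "\<beta> * (\<beta> + 1) < 0" "r \<noteq> 0" "r < t" "(t - r) * X1 \<beta> r m p \<ge> 1"
        | "\<beta> * (\<beta> + 1) > 0" "r \<noteq> 0" "r < t" "m * (m - p) \<le> 0" "(t - r) * X2 \<beta> r m p \<ge> 1"
      proof -
        have "\<beta> * m * (m - (\<beta> + 1) * p) \<ge> 0"
          if "\<beta> \<in> {-1<..<0}" "0 \<le> p * m" "p * m \<le> (\<beta> + 1) * p\<^sup>2"
        proof -
          \<comment> \<open>Since \<beta> is negative, the two bounds on \<open>p * m\<close>
            multiply to \<open>p\<^sup>2\<close> times the discriminant coefficient.\<close>
          have "0 \<le> - \<beta> * (p * m) * ((\<beta> + 1) * p\<^sup>2 - p * m)"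
            using that by (metis diff_ge_0_iff_ge greaterThanLessThan_iff
              less_imp_le mult_nonneg_nonneg neg_0_le_iff_le)
          also have "\<dots> = p\<^sup>2 * (\<beta> * m * (m - (\<beta> + 1) * p))"
            by (simp add: power2_eq_square algebra_simps)
          finally show ?thesis using assms(4) by (simp add: zero_le_mult_iff)
        qed
        moreover have "m * r * p * \<beta> \<le> 0" if "\<beta> \<in> {-1<..<0}" "m * r * p \<ge> 0"
          using that by (simp add: mult_nonneg_nonpos)
        \<comment> \<open>The \<open>X1\<close> alternative assumes \<open>r < 0\<close>, and
          \<open>t \<ge> 0\<close> turns this into the form the sixth case asks for.\<close>
        moreover have "r \<noteq> 0 \<and> r < t" if "r < 0" using that assms(3) by simp
        ultimately show ?thesis using cases outer inner that by argo
      qed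
      then show ?thesis
      proof cases
        case 1
        then show ?thesis by (auto simp: hess_form_def mult_nonpos_nonneg)
      next
        case 2
        have "m * (m + p) * r * x \<ge> 0" using 2 xy by simp
        moreover have "m * (m - p) * t * s \<le> 0" using 2 s_pos by (simp add: mult_nonpos_nonneg)
        ultimately show ?thesis
          using xy unfolding \<open>\<beta> = -1\<close> hess_form_minus_one
          by (intro mult_nonneg_nonpos) (auto simp: mult.assoc)
      next
        case 3
        \<comment> \<open>Again \<open>x\<close> is at most \<open>T\<close>, hence at most the
          zero, but the slope coefficient is now negative and reverses the comparison.\<close>
        have "m * (m + p) * r * x \<ge> m * (m + p) * r * ((m - p) * t * s / ((m + p) * r))"
          using 3 x_le_T[OF x] by (intro mult_left_mono_neg) auto
        also have "m * (m + p) * r * ((m - p) * t * s / ((m + p) * r)) = m * (m - p) * (t * s)"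
          using 3 by (intro at_T) auto
        finally show ?thesis
          using xy unfolding \<open>\<beta> = -1\<close> hess_form_minus_one by (intro mult_nonneg_nonpos) auto
      next
        case 4
        then show ?thesis by (rule hess_form_nonpos_of_discriminant)
      next
        case 5
        have "m * (m - p) * (t * s - r * x)\<^sup>2 \<le> 0" using 5 by (simp add: mult_nonpos_nonneg)
        moreover have "m * r * p * \<beta> * (x * (t * s - r * x)) \<le> 0"
          using xy by (intro mult_nonpos_nonneg[OF 5(2)]) simp
        moreover have "\<beta> * (\<beta> + 1) * (p * r * x)\<^sup>2 \<le> 0"
          using 5 by (meson less_imp_le mult_nonpos_nonneg zero_le_power2)
        ultimately show ?thesis unfolding hess_form_def by linarith
      next
        case 6
        have nz: "\<beta> * (\<beta> + 1) * r \<noteq> 0" using 6 by auto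
        show ?thesis
          unfolding form[OF x nz] using 6 F_X1[OF x nz] by (metis less_imp_le mult_nonpos_nonneg)
      next
        case 7
        have nz: "\<beta> * (\<beta> + 1) * r \<noteq> 0" using 7 by auto
        have "m * (m - p) / (\<beta> * (\<beta> + 1)) \<le> 0" using 7 by (intro divide_nonpos_pos)
        then show ?thesis
          unfolding form[OF x nz] using 7 F_X2[OF x nz] by (metis less_imp_le mult_nonneg_nonpos)
      qed
    qed
    then have "g'' x \<le> 0" if "x \<in> C" for x
      using that g_nonneg by (simp add: g''_def divide_nonpos_nonneg mult_nonneg_nonpos)
    then have "concave_on C g" using f''_le0_imp_concave[OF C_convex] D1 D2 by blast
    \<comment> \<open>Jensen is applied to \<open>- g\<close>.\<close>
    then have "convex_on C (\<lambda>x. - g x)" by (simp add: concave_on_def)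
    then have "card {1..n} * (- g (sum b {1..n} / card {1..n})) \<le> (\<Sum>i=1..n. - g (b i))"
      using assms(1) b_C by (intro jensen_sum) auto
    then show ?upper unfolding sum_g mean_g by (simp add: sum_negf)
  qed
qed

end
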